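(* For every integer $N\ge1$ and every integer $n\ge0$, the following identity holds (as rational functions in $x$): $$U_{n}^{(N+1)}(x)=\frac{1}{2^{N}N!}\sum_{i=1}^{N}a_{i}(N)\sum_{l=0}^{n}\binom{2N+n-l-i-1}{n-l}U_{l+i}(x)\,x^{i+l-2N-n}\,(l+i)_{i}.$$
   Context: The Chebyshev polynomials of the second kind $U_n(x)$ and the higher-order ones $U_n^{(\alpha)}(x)$ are defined by the formal power series in $t$ $$\frac{1}{1-2xt+t^{2}}=\sum_{n=0}^{\infty}U_{n}(x)t^{n},\qquad \left(\frac{1}{1-2xt+t^{2}}\right)^{\alpha}=\sum_{n=0}^{\infty}U_{n}^{(\alpha)}(x)t^{n}.$$ For a number $y$ and integer $n\ge1$, $(y)_{n}=y(y-1)\cdots(y-n+1)$ is the falling factorial, and $(y)_{0}=1$. The double factorial is $(2k-1)!!=(2k-1)(2k-3)\cdots 3\cdot 1$ for $k\ge1$, with $(-1)!!=1$. The numbers $a_i(N)$, $1\le i\le N$, are defined by $a_{1}(N)=(2N-3)!!$ and, for $2\le i\le N$, $$a_{i}(N)=\sum_{k_{i-1}=0}^{N-i}\ \sum_{k_{i-2}=0}^{N-i-k_{i-1}}\cdots\sum_{k_{1}=0}^{N-i-k_{i-1}-\cdots-k_{2}}2^{\sum_{j=1}^{i-1}k_{j}}\left[\prod_{j=2}^{i}\left(N-\sum_{l=j}^{i-1}k_{l}-\frac{2i+2-j}{2}\right)_{k_{j-1}}\right]\left(2\left(N-i-\sum_{j=1}^{i-1}k_{j}\right)-1\right)!!,$$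 where empty sums are $0$. *)

theory Defs
  imports "HOL-Computational_Algebra.Computational_Algebra"
begin

lemma of_nat_fract: "of_nat n = Fract (of_nat n) (1 :: 'a :: idom)"
  by (induction n) (simp_all add: Zero_fract_def One_fract_def)

text \<open>
  The library only knows that fields of fractions of \<^emph>\<open>ordered\<close> domains have characteristic
  zero. We need it for rational functions over an arbitrary field of characteristic zero.
\<close>

instance fract :: ("{idom, ring_char_0}") field_char_0
proof
  show "inj (of_nat :: nat \<Rightarrow> 'a fract)"
    by (rule injI) (simp add: of_nat_fract eq_fract)
qed

text \<open>
  Both families are defined for an arbitrary element \<open>x\<close> of a field, so that \<open>x\<close> may be
  a number as well as the indeterminate of a field of rational functions. The series being
  inverted has constant coefficient 1. The order \<open>\<alpha>\<close> is a natural number here, so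
  that the power is the ordinary one.
\<close>

definition cheb_U :: "'a :: field_char_0 \<Rightarrow> nat \<Rightarrow> 'a" where
  "cheb_U x n = fps_nth (inverse (1 - fps_const (2 * x) * fps_X + fps_X ^ 2)) n"

definition cheb_U_order :: "nat \<Rightarrow> 'a :: field_char_0 \<Rightarrow> nat \<Rightarrow> 'a" where
  "cheb_U_order \<alpha> x n =
     fps_nth ((inverse (1 - fps_const (2 * x) * fps_X + fps_X ^ 2)) ^ \<alpha>) n"

definition falling_fact :: "'a :: field_char_0 \<Rightarrow> nat \<Rightarrow> 'a" where
  "falling_fact y n = (\<Prod>m<n. y - of_nat m)"

text \<open>The argument \<open>k\<close> stands for \<open>(2k - 1)!!\<close>; in particular \<open>odd_double_fact 0 = (-1)!! = 1\<close>.\<close>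

definition odd_double_fact :: "nat \<Rightarrow> nat" where
  "odd_double_fact k = (\<Prod>j=1..k. 2 * j - 1)"

text \<open>
  \<open>nested_sum m R k F\<close> is the iterated sum over the variables \<open>k m, k (m - 1), \<dots>, k 1\<close>,
  from the outermost to the innermost, where \<open>k m\<close> ranges over \<open>0..R\<close>, \<open>k (m - 1)\<close> over
  \<open>0..R - k m\<close>, and so on down to \<open>k 1\<close>, ranging over \<open>0..R - k m - \<dots> - k 2\<close>.
\<close>

fun nested_sum :: "nat \<Rightarrow> nat \<Rightarrow> (nat \<Rightarrow> nat) \<Rightarrow> ((nat \<Rightarrow> nat) \<Rightarrow> 'a) \<Rightarrow> 'a :: comm_monoid_add" where
  "nested_sum 0 R k F = F k"
| "nested_sum (Suc m) R k F = (\<Sum>v=0..R. nested_sum m (R - v) (k(Suc m := v)) F)"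

text \<open>
  Only \<open>1 \<le> i \<le> N\<close> is meaningful. In that range none of the subtractions on natural numbers
  below is truncated, and \<open>odd_double_fact (N - 1) = (2N - 3)!!\<close>.
\<close>

definition cheb_a :: "nat \<Rightarrow> nat \<Rightarrow> 'a :: field_char_0" where
  "cheb_a i N =
     (if i = 1 then of_nat (odd_double_fact (N - 1))
      else nested_sum (i - 1) (N - i) (\<lambda>_. 0)
        (\<lambda>k. 2 ^ (\<Sum>j=1..i-1. k j) *
             (\<Prod>j=2..i. falling_fact
                (of_nat N - (\<Sum>l=j..i-1. of_nat (k l)) - of_nat (2 * i + 2 - j) / 2) (k (j - 1))) *
             of_nat (odd_double_fact (N - i - (\<Sum>j=1..i-1. k j)))))"

end

theory Submission
  imports Defs
begin

text \<open>
  Let \<open>F = 1 / (1 - 2xt + t\<^sup>2)\<close>. Since \<open>F' = 2(x - t)F\<^sup>2\<close>, differentiating repeatedly and dividing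
  by \<open>x - t\<close> each time yields
  \<open>2\<^sup>N N! F\<^bsup>N+1\<^esup> = (\<Sum>i=1..N. a i N * (x - t)\<^bsup>i-2N\<^esup> * F\<^bsup>(i)\<^esup>)\<close>, where
  \<open>a i (N+1) = (2N - i) * a i N + a (i-1) N\<close>. The nested sums are this recurrence solved in \<open>N\<close> for
  one \<open>i\<close> after the other. The theorem compares the coefficients of \<open>t\<^bsup>n\<^esup>\<close>.
\<close>

section \<open>Nested sums and the recurrence for \<open>cheb_a\<close>\<close>

text \<open>The base assignments \<open>k\<close> and \<open>k'\<close> may disagree outside
  \<open>{1..m}\<close>. This permits forgetting the value of an already fixed outer variable once
  its effect on the summand is captured by the factor \<open>c\<close>.\<close>

lemma nested_sum_cong_scale:
  fixes F F' :: "(nat \<Rightarrow> nat) \<Rightarrow> 'a :: semiring_0"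
  assumes "\<And>h h'. (\<And>j. j \<in> {1..m} \<Longrightarrow> h j = h' j) \<Longrightarrow> (\<And>j. j \<notin> {1..m} \<Longrightarrow> h j = k j) \<Longrightarrow>
             (\<And>j. j \<notin> {1..m} \<Longrightarrow> h' j = k' j) \<Longrightarrow> F h = c * F' h'"
  shows "nested_sum m R k F = c * nested_sum m R k' F'"
  using assms
proof (induction m arbitrary: R k k')
  case 0
  then show ?case by simp
next
  case (Suc m)
  have "nested_sum m (R - v) (k(Suc m := v)) F = c * nested_sum m (R - v) (k'(Suc m := v)) F'" for v
  proof (rule Suc.IH)
    fix h h' :: "nat \<Rightarrow> nat"
    assume h: "\<And>j. j \<in> {1..m} \<Longrightarrow> h j = h' j" "\<And>j. j \<notin> {1..m} \<Longrightarrow> h j = (k(Suc m := v)) j"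
      "\<And>j. j \<notin> {1..m} \<Longrightarrow> h' j = (k'(Suc m := v)) j"
    show "F h = c * F' h'"
    proof (rule Suc.prems)
      fix j
      \<comment> \<open>At \<open>Suc m\<close>, outside the range of the inner sum, both
        assignments take the value \<open>v\<close>.\<close>
      show "h j = h' j" if "j \<in> {1..Suc m}"
        using that h(1)[of j] h(2)[of j] h(3)[of j] by (cases "j = Suc m") auto
      show "h j = k j" "h' j = k' j" if "j \<notin> {1..Suc m}"
        using that h(2)[of j] h(3)[of j] by auto
    qed
  qed
  then show ?case by (simp add: sum_distrib_left)
qed

text \<open>For \<open>i = 1\<close> there are no summation variables and the product is empty, so
  the general formula already gives the double factorial. This removes the case distinction.\<close>

lemma cheb_a_eq_nested_sum:
  assumes "i \<ge> 1"
  shows "cheb_a i N = nested_sum (i - 1) (N - i) (\<lambda>_. 0)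
        (\<lambda>k. 2 ^ (\<Sum>j=1..i-1. k j) *
             (\<Prod>j=2..i. falling_fact
                (of_nat N - (\<Sum>l=j..i-1. of_nat (k l)) - of_nat (2 * i + 2 - j) / 2) (k (j - 1))) *
             of_nat (odd_double_fact (N - i - (\<Sum>j=1..i-1. k j))))"
  using assms by (cases "i = 1") (simp_all add: cheb_a_def)

text \<open>Fix the outermost variable \<open>k i = v\<close>. It contributes \<open>2 ^ v\<close>
  and the last factor of the product; everywhere else it only replaces \<open>N\<close> by
  \<open>N - 1 - v\<close>, which leaves the nested sum of
  \<open>cheb_a i (N - 1 - v)\<close>.\<close>

lemma cheb_a_eq_sum:
  assumes "i \<ge> 1" "Suc i \<le> N"
  shows "(cheb_a (Suc i) N :: 'a :: field_char_0) =
    (\<Sum>v=0..N - Suc i. 2 ^ v * falling_fact (of_nat N - of_nat (i + 3) / 2) v * cheb_a i (N - 1 - v))"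
proof -
  obtain m where m: "i = Suc m" using assms(1) by (cases i) auto
  define G :: "nat \<Rightarrow> nat \<Rightarrow> (nat \<Rightarrow> nat) \<Rightarrow> 'a" where "G i N = (\<lambda>k. 2 ^ (\<Sum>j=1..i-1. k j) *
             (\<Prod>j=2..i. falling_fact
                (of_nat N - (\<Sum>l=j..i-1. of_nat (k l)) - of_nat (2 * i + 2 - j) / 2) (k (j - 1))) *
             of_nat (odd_double_fact (N - i - (\<Sum>j=1..i-1. k j))))" for i N
  have "nested_sum m (N - Suc i - v) ((\<lambda>_. 0)(i := v)) (G (Suc i) N) =
      (2 ^ v * falling_fact (of_nat N - of_nat (i + 3) / 2) v) *
      nested_sum m (N - 1 - v - i) (\<lambda>_. 0) (G i (N - 1 - v))" if v: "v \<in> {0..N - Suc i}" for v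
  proof -
    have "N - Suc i - v = N - 1 - v - i" by simp
    moreover have "G (Suc i) N h = (2 ^ v * falling_fact (of_nat N - of_nat (i + 3) / 2) v) * G i (N - 1 - v) h'"
      if h: "\<And>j. j \<in> {1..m} \<Longrightarrow> h j = h' j" "\<And>j. j \<notin> {1..m} \<Longrightarrow> h j = ((\<lambda>_. 0)(i := v)) j" for h h'
    proof -
      have hi: "h i = v" using h(2)[of i] m by simp
      have S: "(\<Sum>j=1..i. h j) = (\<Sum>j=1..i-1. h' j) + v"
        using hi h(1) m by (auto intro!: sum.cong)
      have P: "(\<Prod>j=2..i. falling_fact
              (of_nat N - (\<Sum>l=j..i. of_nat (h l)) - of_nat (2 * Suc i + 2 - j) / 2) (h (j - 1))) =
            (\<Prod>j=2..i. falling_fact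
              (of_nat (N - 1 - v) - (\<Sum>l=j..i-1. of_nat (h' l)) - of_nat (2 * i + 2 - j) / 2 :: 'a) (h' (j - 1)))"
      proof (rule prod.cong)
        fix j assume j: "j \<in> {2..i}"
        have 1: "(\<Sum>l=j..i. of_nat (h l)) = (\<Sum>l=j..i-1. of_nat (h' l)) + (of_nat v :: 'a)"
          using hi h(1) m j by (auto intro!: sum.cong)
        have 2: "h (j - 1) = h' (j - 1)" using j m by (intro h(1)) auto
        have 3: "(of_nat (N - 1 - v) :: 'a) = of_nat N - 1 - of_nat v"
          using v assms by (simp add: of_nat_diff)
        \<comment> \<open>Halved, the extra 2 supplies the 1 in \<open>N - 1 - v\<close>; the
          \<open>v\<close> is the top summand split off in fact 1.\<close>
        have 4: "2 * Suc i + 2 - j = (2 * i + 2 - j) + 2" using j by auto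
        show "falling_fact (of_nat N - (\<Sum>l=j..i. of_nat (h l)) - of_nat (2 * Suc i + 2 - j) / 2) (h (j - 1)) =
          falling_fact
              (of_nat (N - 1 - v) - (\<Sum>l=j..i-1. of_nat (h' l)) - of_nat (2 * i + 2 - j) / 2 :: 'a) (h' (j - 1))"
          unfolding 1 2 3 4 of_nat_add by (simp add: add_divide_distrib algebra_simps)
      qed simp
      \<comment> \<open>At \<open>j = Suc i\<close> the sum over \<open>l\<close> is empty and the
        shift is \<open>(i + 3) / 2\<close>.\<close>
      have insert: "{2..Suc i} = insert (Suc i) {2..i}" using m by auto
      have Q: "(\<Prod>j=2..Suc i. falling_fact
              (of_nat N - (\<Sum>l=j..i. of_nat (h l)) - of_nat (2 * Suc i + 2 - j) / 2) (h (j - 1))) =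
            falling_fact (of_nat N - of_nat (i + 3) / 2 :: 'a) v *
            (\<Prod>j=2..i. falling_fact
              (of_nat (N - 1 - v) - (\<Sum>l=j..i-1. of_nat (h' l)) - of_nat (2 * i + 2 - j) / 2 :: 'a) (h' (j - 1)))"
        unfolding insert P[symmetric] using hi by simp
      have R: "N - Suc i - ((\<Sum>j=1..i-1. h' j) + v) = N - 1 - v - i - (\<Sum>j=1..i-1. h' j)" by simp
      show ?thesis
        unfolding G_def diff_Suc_1 S Q R by (simp add: power_add)
    qed
    ultimately show ?thesis
      by (intro nested_sum_cong_scale[where k' = "\<lambda>_. 0" and k = "(\<lambda>_. 0)(i := v)", THEN trans]) auto
  qed
  then have "nested_sum i (N - Suc i) (\<lambda>_. 0) (G (Suc i) N) =
    (\<Sum>v=0..N - Suc i. (2 ^ v * falling_fact (of_nat N - of_nat (i + 3) / 2) v) *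
      nested_sum m (N - 1 - v - i) (\<lambda>_. 0) (G i (N - 1 - v)))"
    unfolding m by (simp del: of_nat_add)
  then show ?thesis
    using assms m by (simp add: cheb_a_eq_nested_sum G_def)
qed

lemma falling_fact_Suc_left: "falling_fact y (Suc n) = y * falling_fact (y - 1) n"
  unfolding falling_fact_def by (simp add: prod.lessThan_Suc_shift algebra_simps del: prod.lessThan_Suc)

lemma cheb_a_one_Suc:
  assumes "N \<ge> 1"
  shows "cheb_a 1 (Suc N) = of_nat (2 * N - 1) * cheb_a 1 N"
  using assms by (cases N) (simp_all add: cheb_a_def odd_double_fact_def distrib_right mult_ac)

text \<open>In the sum for \<open>Suc N\<close> the term \<open>v = 0\<close> is
  \<open>cheb_a i N\<close>. Each later term contains \<open>2 * y = 2 * N - Suc i\<close>, and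
  pulling it out leaves the sum for \<open>N\<close>.\<close>

lemma cheb_a_Suc_Suc:
  assumes "i \<ge> 1" "Suc i \<le> N"
  shows "(cheb_a (Suc i) (Suc N) :: 'a :: field_char_0) =
    of_nat (2 * N - Suc i) * cheb_a (Suc i) N + cheb_a i N"
proof -
  define y :: 'a where "y = of_nat (Suc N) - of_nat (i + 3) / 2"
  have y: "2 * y = of_nat (2 * N - Suc i)" "y - 1 = of_nat N - of_nat (i + 3) / 2"
    using assms by (simp_all add: y_def of_nat_diff algebra_simps)
  have "cheb_a (Suc i) (Suc N) = (\<Sum>v=0..Suc (N - Suc i). 2 ^ v * falling_fact y v * cheb_a i (N - v))"
    using assms by (simp add: cheb_a_eq_sum y_def Suc_diff_Suc del: of_nat_add)
  also have "\<dots> = cheb_a i N +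
      (\<Sum>v=0..N - Suc i. 2 ^ Suc v * falling_fact y (Suc v) * cheb_a i (N - Suc v))"
    by (subst sum.atLeast0_atMost_Suc_shift) (simp add: falling_fact_def)
  also have "(\<Sum>v=0..N - Suc i. 2 ^ Suc v * falling_fact y (Suc v) * cheb_a i (N - Suc v)) =
      2 * y * cheb_a (Suc i) N"
    by (simp add: cheb_a_eq_sum[OF assms] falling_fact_Suc_left sum_distrib_left y(2) mult_ac)
  finally show ?thesis by (simp add: y(1) del: of_nat_diff)
qed

text \<open>The boundary case outside the recurrence: only the term \<open>v = 0\<close>
  occurs.\<close>

lemma cheb_a_diag_Suc:
  assumes "N \<ge> 1"
  shows "cheb_a (Suc N) (Suc N) = cheb_a N N"
  using assms by (simp add: cheb_a_eq_sum falling_fact_def)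

section \<open>The differential identity for powers of the generating function\<close>

text \<open>Induction on \<open>N\<close>, applying the operator \<open>v * fps_deriv\<close> to
  both sides. As \<open>x \<noteq> 0\<close>, the series \<open>x - t\<close> is invertible and
  \<open>v\<close> is its genuine inverse.\<close>

lemma power_cheb_gf_eq_sum:
  fixes x :: "'a :: field_char_0"
  assumes "x \<noteq> 0" "N \<ge> 1"
  defines "F \<equiv> inverse (1 - fps_const (2 * x) * fps_X + fps_X ^ 2)"
    and "v \<equiv> inverse (fps_const x - fps_X)"
  shows "fps_const (2 ^ N * fact N) * F ^ (N + 1) =
    (\<Sum>i=1..N. fps_const (cheb_a i N) * v ^ (2 * N - i) * (fps_deriv ^^ i) F)"
proof -
  have wv: "(fps_const x - fps_X) * v = 1"
    unfolding v_def using assms(1) by (intro inverse_mult_eq_1') simp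
  have dv: "fps_deriv v = v ^ 2"
    unfolding v_def using assms(1) by (subst fps_inverse_deriv) (simp_all add: power2_eq_square)
  have dF: "v * fps_deriv F = 2 * F ^ 2"
  proof -
    have "fps_deriv F = 2 * (fps_const x - fps_X) * F ^ 2"
      unfolding F_def
      by (subst fps_inverse_deriv)
        (simp_all add: power2_eq_square algebra_simps numeral_fps_const)
    then have "v * fps_deriv F = 2 * ((fps_const x - fps_X) * v) * F ^ 2"
      by (simp only: mult_ac)
    then show ?thesis by (simp add: wv)
  qed
  have c2: "fps_const (2 * c) = 2 * fps_const c" for c :: 'a
    by (simp add: numeral_fps_const)
  define T where "T = (\<lambda>N i. v ^ (2 * N - i) * (fps_deriv ^^ i) F)"
  \<comment> \<open>The two summands come from differentiating the power of \<open>v\<close>, where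
    \<open>v' = v ^ 2\<close>, and the derivative of \<open>F\<close>. Since
    \<open>i \<le> N\<close>, the exponent \<open>2 * N - i\<close> is positive.\<close>
  have dT: "v * fps_deriv (T N i) = of_nat (2 * N - i) * T (Suc N) i + T (Suc N) (Suc i)"
    if i: "i \<in> {1..N}" for N i
  proof -
    obtain k where k: "2 * N - i = Suc k" using i by (cases "2 * N - i") auto
    then have e: "2 * Suc N - i = k + 3" "2 * Suc N - Suc i = k + 2" by auto
    have dv_power: "fps_deriv (v ^ Suc k) = of_nat (Suc k) * v ^ (k + 2)"
      unfolding fps_deriv_power by (simp add: dv power2_eq_square power_add mult_ac fps_of_nat del: of_nat_Suc)
    show ?thesis
      unfolding T_def k e fps_deriv_mult dv_power
      by (simp add: algebra_simps power2_eq_square power3_eq_cube power_add del: of_nat_Suc)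
  qed
  have "fps_const (2 ^ N * fact N) * F ^ (N + 1) = (\<Sum>i=1..N. fps_const (cheb_a i N) * T N i)"
    using assms(2)
  proof (induction N rule: nat_induct_at_least)
    case base
    show ?case using dF by (simp add: T_def cheb_a_def odd_double_fact_def numeral_fps_const power2_eq_square)
  next
    case (Suc N)
    let ?a = "\<lambda>i N. fps_const (cheb_a i N :: 'a)"
    \<comment> \<open>The new factor \<open>Suc N\<close> is that of the power rule for
      \<open>F ^ (N + 1)\<close>, and \<open>2 * F ^ 2\<close> is
      \<open>v * fps_deriv F\<close>.\<close>
    have "fps_const (2 ^ Suc N * fact (Suc N)) * F ^ (Suc N + 1) =
        fps_const (2 ^ N * fact N) * (of_nat (Suc N) * F ^ N * (2 * F ^ 2))"
      by (simp add: c2 power2_eq_square mult_ac flip: fps_const_mult fps_of_nat)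
    also have "\<dots> = v * fps_deriv (fps_const (2 ^ N * fact N) * F ^ (N + 1))"
      unfolding dF[symmetric] by (simp add: fps_deriv_power fps_of_nat mult_ac del: power_Suc of_nat_Suc)
    also have "\<dots> = (\<Sum>i=1..N. ?a i N * (v * fps_deriv (T N i)))"
      unfolding Suc.IH by (simp add: fps_deriv_sum sum_distrib_left mult_ac)
    also have "\<dots> = (\<Sum>i=1..N. ?a i N * of_nat (2 * N - i) * T (Suc N) i) +
        (\<Sum>i=1..N. ?a i N * T (Suc N) (Suc i))"
      unfolding sum.distrib[symmetric]
      by (intro sum.cong refl) (simp only: dT distrib_left mult.assoc)
    also have "\<dots> = (\<Sum>i=1..Suc N. ?a i (Suc N) * T (Suc N) i)"
    proof -
      \<comment> \<open>Compare the coefficients of \<open>T (Suc N) i\<close>: index 1 arises only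
        from the first sum, index \<open>Suc N\<close> only from the second, and those between from
        both, by the recurrence.\<close>
      obtain M where M: "N = Suc M" using Suc.hyps by (cases N) auto
      have shift: "(\<Sum>i=1..Suc m. f i) = f 1 + (\<Sum>i=1..m. f (Suc i))" for f :: "nat \<Rightarrow> 'a fps" and m
        by (induction m) (simp_all add: add_ac)
      have "?a 1 N * of_nat (2 * N - 1) = ?a 1 (Suc N)"
        using cheb_a_one_Suc[OF Suc.hyps, where 'a = 'a]
        by (simp add: mult.commute fps_of_nat[symmetric])
      then have lower: "(\<Sum>i=1..N. ?a i N * of_nat (2 * N - i) * T (Suc N) i) =
          ?a 1 (Suc N) * T (Suc N) 1 +
          (\<Sum>i=1..M. ?a (Suc i) N * of_nat (2 * N - Suc i) * T (Suc N) (Suc i))"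
        unfolding M shift by simp
      have upper: "(\<Sum>i=1..N. ?a i N * T (Suc N) (Suc i)) =
          (\<Sum>i=1..M. ?a i N * T (Suc N) (Suc i)) + ?a N N * T (Suc N) (Suc N)"
        by (simp add: M)
      have total: "(\<Sum>i=1..Suc N. ?a i (Suc N) * T (Suc N) i) =
          ?a 1 (Suc N) * T (Suc N) 1 +
          ((\<Sum>i=1..M. ?a (Suc i) (Suc N) * T (Suc N) (Suc i)) + ?a (Suc N) (Suc N) * T (Suc N) (Suc N))"
        unfolding shift by (simp add: M)
      have "?a (Suc i) (Suc N) = ?a (Suc i) N * of_nat (2 * N - Suc i) + ?a i N"
        if "i \<in> {1..M}" for i
        using that M
        by (subst cheb_a_Suc_Suc)
          (simp_all add: fps_of_nat[symmetric] mult_ac del: of_nat_diff flip: fps_const_add fps_const_mult)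
      then have middle: "(\<Sum>i=1..M. ?a (Suc i) (Suc N) * T (Suc N) (Suc i)) =
          (\<Sum>i=1..M. ?a (Suc i) N * of_nat (2 * N - Suc i) * T (Suc N) (Suc i)) +
          (\<Sum>i=1..M. ?a i N * T (Suc N) (Suc i))"
        unfolding sum.distrib[symmetric] by (intro sum.cong refl) (simp only: distrib_right)
      show ?thesis
        unfolding lower upper total middle cheb_a_diag_Suc[OF Suc.hyps] by (simp only: add_ac)
    qed
    finally show ?case .
  qed
  then show ?thesis by (simp add: T_def mult_ac)
qed

section \<open>Extraction of coefficients\<close>

lemma fps_nth_funpow_deriv:
  fixes f :: "'a :: field_char_0 fps"
  shows "fps_nth ((fps_deriv ^^ i) f) l = falling_fact (of_nat (l + i)) i * fps_nth f (l + i)"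
proof (induction i arbitrary: l)
  case (Suc i)
  have "falling_fact (of_nat (Suc l + i)) (Suc i) =
    falling_fact (of_nat (Suc l + i)) i * (of_nat (Suc l) :: 'a)"
    by (simp add: falling_fact_def)
  then show ?case using Suc[of "Suc l"] by (simp add: mult_ac)
qed (simp add: falling_fact_def)

text \<open>Write \<open>x - t = x * (1 - t / x)\<close> and apply the negative binomial
  series.\<close>

lemma fps_nth_inverse_const_minus_X_power:
  fixes x :: "'a :: field_char_0"
  assumes "x \<noteq> 0" "m \<ge> 1"
  shows "fps_nth (inverse (fps_const x - fps_X) ^ m) k =
    of_nat ((m + k - 1) choose k) * x powi (- int m - int k)"
proof -
  have factored: "fps_const x - fps_X = fps_const x * (1 - fps_const (inverse x) * fps_X)"
    using assms(1) by (simp add: algebra_simps flip: mult.assoc)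
  have "inverse (fps_const x - fps_X) ^ m =
      fps_const (inverse x ^ m) * inverse ((1 - fps_const (inverse x) * fps_X) ^ m)"
    unfolding factored by (simp add: fps_inverse_mult fps_inverse_power power_mult_distrib fps_const_inverse fps_const_power)
  moreover have "x powi (- int m - int k) = inverse x ^ m * inverse x ^ k"
    using assms(1) by (simp add: power_int_diff power_int_minus field_simps)
  moreover have "fps_nth (inverse ((1 - fps_const (inverse x) * fps_X) ^ m)) k =
      of_nat ((m + k - 1) choose k) * inverse x ^ k"
    using assms(2) by (simp add: one_minus_const_fps_X_neg_power')
  ultimately show ?thesis by (simp add: mult_ac)
qed

text \<open>The inner sum over \<open>l\<close> is the Cauchy product of an iterated derivative of
  the generating function with a power of \<open>1 / (x - t)\<close>.\<close>

lemma cheb_U_order_eq_sum: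
  fixes x :: "'a :: field_char_0"
  assumes "x \<noteq> 0" "N \<ge> 1"
  shows "cheb_U_order (N + 1) x n =
    1 / (2 ^ N * fact N) *
    (\<Sum>i=1..N. cheb_a i N *
      (\<Sum>l=0..n. of_nat ((2 * N + n - l - i - 1) choose (n - l)) * cheb_U x (l + i) *
         x powi (int i + int l - 2 * int N - int n) * falling_fact (of_nat (l + i)) i))"
proof -
  let ?F = "inverse (1 - fps_const (2 * x) * fps_X + fps_X ^ 2)"
  let ?v = "inverse (fps_const x - fps_X)"
  have "2 ^ N * fact N * cheb_U_order (N + 1) x n =
      fps_nth (\<Sum>i=1..N. fps_const (cheb_a i N) * ?v ^ (2 * N - i) * (fps_deriv ^^ i) ?F) n"
    unfolding power_cheb_gf_eq_sum[OF assms, symmetric] cheb_U_order_def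
    by (rule fps_mult_left_const_nth[symmetric])
  \<comment> \<open>With the derivative on the left, it receives the index \<open>l\<close> and the
    power of \<open>?v\<close> receives \<open>n - l\<close>.\<close>
  also have "\<dots> = (\<Sum>i=1..N. cheb_a i N * fps_nth ((fps_deriv ^^ i) ?F * ?v ^ (2 * N - i)) n)"
    by (simp add: fps_sum_nth mult.assoc mult.commute[of "?v ^ _"])
  also have "\<dots> = (\<Sum>i=1..N. cheb_a i N *
      (\<Sum>l=0..n. of_nat ((2 * N + n - l - i - 1) choose (n - l)) * cheb_U x (l + i) *
         x powi (int i + int l - 2 * int N - int n) * falling_fact (of_nat (l + i)) i))"
  proof (intro sum.cong refl arg_cong2[of _ _ _ _ "(*)"])
    fix i assume i: "i \<in> {1..N}"
    have "fps_nth (?v ^ (2 * N - i)) (n - l) = of_nat ((2 * N + n - l - i - 1) choose (n - l)) *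
        x powi (int i + int l - 2 * int N - int n)" if "l \<in> {0..n}" for l
    proof -
      \<comment> \<open>The bounds \<open>i \<le> N\<close> and \<open>l \<le> n\<close> prevent
        truncation of the natural subtractions.\<close>
      have eqs: "2 * N - i + (n - l) - 1 = 2 * N + n - l - i - 1"
        "- int (2 * N - i) - int (n - l) = int i + int l - 2 * int N - int n"
        using i that by auto
      have "2 * N - i \<ge> 1" using i by auto
      from fps_nth_inverse_const_minus_X_power[OF assms(1) this, of "n - l"]
      show ?thesis unfolding eqs .
    qed
    then show "fps_nth ((fps_deriv ^^ i) ?F * ?v ^ (2 * N - i)) n =
      (\<Sum>l=0..n. of_nat ((2 * N + n - l - i - 1) choose (n - l)) * cheb_U x (l + i) *
         x powi (int i + int l - 2 * int N - int n) * falling_fact (of_nat (l + i)) i)"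
      unfolding fps_mult_nth
      by (intro sum.cong) (simp_all add: fps_nth_funpow_deriv cheb_U_def mult_ac)
  qed
  finally show ?thesis by (simp add: field_simps)
qed

theorem theorem2:
  fixes N n :: nat and x :: "'k :: field_char_0 poly fract"
  assumes "N \<ge> 1" and "x = Fract [:0, 1:] 1"
  shows "cheb_U_order (N + 1) x n =
    1 / (2 ^ N * fact N) *
    (\<Sum>i=1..N. cheb_a i N *
      (\<Sum>l=0..n. of_nat ((2 * N + n - l - i - 1) choose (n - l)) * cheb_U x (l + i) *
         x powi (int i + int l - 2 * int N - int n) * falling_fact (of_nat (l + i)) i))"
proof (rule cheb_U_order_eq_sum)
  show "x \<noteq> 0"
    unfolding assms(2) Zero_fract_def by (simp add: eq_fract)
qed (rule assms(1))

end
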